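(* Suppose that $G$ is a levelable graph and let $x$ be a vertex of $G$. Then both the duplication $G^x$ and the expansion $G^{[x]}$ of $G$ at $x$ are levelable.
   Context: All graphs are finite and simple. A graph $G$ on $\{x_1,\ldots,x_n\}$ is levelable if there exist positive integers $c_1,\ldots,c_n$ and a constant $c$ such that $\sum_{x_i\in W}c_i=c$ for every maximal (under inclusion) independent set $W$ of $G$. For a vertex $x$ of $G$: the duplication $G^x$ of $G$ at $x$ is the graph obtained by adding a new vertex $y$ to $G$, with edge set $E(G^x)=E(G)\cup\{\{y,b\} : \{x,b\}\in E(G)\}$. The expansion $G^{[x]}$ of $G$ at $x$ is the graph obtained by adding a new vertex $y$ to $G$, with edge set $E(G^{[x]})=E(G^x)\cup\{\{x,y\}\}$. *)

theory Defs
  imports Main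
begin

record 'a graph =
  verts :: "'a set"
  edges :: "'a set set"

definition simple_graph :: "'a graph \<Rightarrow> bool" where
  "simple_graph G \<longleftrightarrow> finite (verts G) \<and> (\<forall>e\<in>edges G. e \<subseteq> verts G \<and> card e = 2)"

definition independent :: "'a graph \<Rightarrow> 'a set \<Rightarrow> bool" where
  "independent G W \<longleftrightarrow> W \<subseteq> verts G \<and> (\<forall>u\<in>W. \<forall>v\<in>W. {u, v} \<notin> edges G)"

definition maximal_independent :: "'a graph \<Rightarrow> 'a set \<Rightarrow> bool" where
  "maximal_independent G W \<longleftrightarrow>
     independent G W \<and> (\<forall>W'. independent G W' \<and> W \<subseteq> W' \<longrightarrow> W' = W)"

definition levelable :: "'a graph \<Rightarrow> bool" where
  "levelable G \<longleftrightarrow> simple_graph G \<and>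
     (\<exists>(w :: 'a \<Rightarrow> int) (c :: int).
        (\<forall>v\<in>verts G. 0 < w v) \<and>
        (\<forall>W. maximal_independent G W \<longrightarrow> (\<Sum>v\<in>W. w v) = c))"

(* The new vertex y is an explicit argument; it is meant to lie outside verts G. *)

definition duplication :: "'a graph \<Rightarrow> 'a \<Rightarrow> 'a \<Rightarrow> 'a graph" where
  "duplication G x y =
     \<lparr>verts = insert y (verts G), edges = edges G \<union> {{y, b} | b. {x, b} \<in> edges G}\<rparr>"

definition expansion :: "'a graph \<Rightarrow> 'a \<Rightarrow> 'a \<Rightarrow> 'a graph" where
  "expansion G x y =
     \<lparr>verts = insert y (verts G), edges = edges (duplication G x y) \<union> {{x, y}}\<rparr>"

end

theory Submission
  imports Defs
begin

text \<open>
  Let \<open>f\<close> collapse the new vertex \<open>y\<close> onto \<open>x\<close>. A set is independent in the duplication iff its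
  image under \<open>f\<close> is independent in \<open>G\<close>, and in the expansion iff moreover \<open>f\<close> is injective on it.
  Hence \<open>f\<close> sends maximal independent sets to maximal independent sets. In the expansion the weights
  \<open>w \<circ> f\<close> work; in the duplication a maximal independent set is a full preimage, so doubling \<open>w\<close> and
  splitting the weight \<open>2 * w x\<close> evenly between \<open>x\<close> and \<open>y\<close> works.
\<close>

definition collapse :: "'a \<Rightarrow> 'a \<Rightarrow> 'a \<Rightarrow> 'a" where
  "collapse x y v = (if v = y then x else v)"

lemma simple_graph_edgeD:
  assumes "simple_graph G" "{u, v} \<in> edges G"
  shows "u \<noteq> v" "u \<in> verts G" "v \<in> verts G"
  using assms by (auto simp: simple_graph_def)

lemma simple_graph_independent_finite:
  "simple_graph G \<Longrightarrow> independent G W \<Longrightarrow> finite W"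
  by (meson finite_subset independent_def simple_graph_def)

lemma image_collapse_id: "y \<notin> W \<Longrightarrow> collapse x y ` W = W"
  by (auto simp: collapse_def image_def)

context
  fixes G :: "'a graph" and x y :: 'a
  assumes simple: "simple_graph G" and x: "x \<in> verts G" and y: "y \<notin> verts G"
begin

lemma simple_graph_duplication: "simple_graph (duplication G x y)"
proof -
  have "y \<noteq> b \<and> b \<in> verts G" if "{x, b} \<in> edges G" for b
    using simple_graph_edgeD[OF simple that] y by blast
  then show ?thesis
    using simple unfolding simple_graph_def duplication_def by auto
qed

lemma simple_graph_expansion: "simple_graph (expansion G x y)"
proof -
  have "x \<noteq> y"
    using x y by blast
  then have "card {x, y} = 2"
    by simp
  then show ?thesis
    using simple_graph_duplication x
    unfolding simple_graph_def expansion_def duplication_def by auto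
qed

text \<open>\<open>G\<close> has no loops, so no edge joins two vertices that both collapse to
  \<open>x\<close>; this matches the non-adjacency of \<open>x\<close> and \<open>y\<close> in the
  duplication. As \<open>y\<close> lies outside \<open>G\<close>, every edge at \<open>y\<close> is
  a copy of an edge at \<open>x\<close>.\<close>

lemma duplication_edge_iff:
  "{u, v} \<in> edges (duplication G x y) \<longleftrightarrow> {collapse x y u, collapse x y v} \<in> edges G"
proof -
  have loop: "{x} \<notin> edges G" and noy: "{y, b} \<notin> edges G" "{b, y} \<notin> edges G" for b
    using simple_graph_edgeD[OF simple, of x x] simple_graph_edgeD[OF simple, of y b]
      simple_graph_edgeD[OF simple, of b y] y by auto
  have "{u, v} \<in> edges (duplication G x y) \<longleftrightarrow>
      {u, v} \<in> edges G \<or> u = y \<and> {x, v} \<in> edges G \<or> v = y \<and> {u, x} \<in> edges G"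
    unfolding duplication_def by (auto simp: doubleton_eq_iff insert_commute)
  then show ?thesis
    \<comment> \<open>In the case \<open>u = v = y\<close> the pair degenerates to
      \<open>{y}\<close>, hence the rewritten instance.\<close>
    using loop noy noy(1)[of y, unfolded insert_absorb2] by (cases "u = y"; cases "v = y") (simp_all add: collapse_def)
qed

lemma independent_duplication_iff:
  "independent (duplication G x y) W \<longleftrightarrow>
     W \<subseteq> insert y (verts G) \<and> independent G (collapse x y ` W)"
proof -
  have "verts (duplication G x y) = insert y (verts G)"
    by (simp add: duplication_def)
  then show ?thesis
    using x unfolding independent_def by (auto simp: duplication_edge_iff collapse_def)
qed

text \<open>The extra edge forbids exactly the sets containing both \<open>x\<close> and
  \<open>y\<close>, the only two vertices that \<open>collapse\<close> identifies.\<close>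

lemma independent_expansion_iff:
  "independent (expansion G x y) W \<longleftrightarrow>
     W \<subseteq> insert y (verts G) \<and> inj_on (collapse x y) W \<and> independent G (collapse x y ` W)"
proof -
  have "independent (expansion G x y) W \<longleftrightarrow>
      independent (duplication G x y) W \<and> \<not> (x \<in> W \<and> y \<in> W)"
    unfolding independent_def expansion_def
    by (auto simp: duplication_def doubleton_eq_iff)
  moreover have "inj_on (collapse x y) W \<longleftrightarrow> \<not> (x \<in> W \<and> y \<in> W)"
    using x y by (auto simp: inj_on_def collapse_def)
  ultimately show ?thesis
    by (auto simp: independent_duplication_iff)
qed

lemma maximal_independent_duplication:
  assumes "maximal_independent (duplication G x y) W"
  obtains U where "maximal_independent G U" "W = (if x \<in> U then insert y U else U)"
proof
  let ?f = "collapse x y"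
  \<comment> \<open>For \<open>U\<close> inside \<open>verts G\<close> this is the full preimage
    under \<open>collapse\<close>.\<close>
  define lift where "lift U = (if x \<in> U then insert y U else U)" for U
  have lift: "independent (duplication G x y) (lift U) \<and> ?f ` lift U = U"
    if "independent G U" for U
  proof -
    have "y \<notin> U" "U \<subseteq> verts G"
      using that y by (auto simp: independent_def)
    then have "?f ` lift U = U"
      using image_collapse_id[of y U x] by (auto simp: lift_def collapse_def)
    then show ?thesis
      using that \<open>U \<subseteq> verts G\<close> by (auto simp: independent_duplication_iff lift_def)
  qed
  \<comment> \<open>The preimage of \<open>U\<close> is independent and contains \<open>W\<close>,
    so maximality forces equality. An arbitrary \<open>U\<close> gives maximality of the image; the
    image itself as \<open>U\<close> recovers \<open>W\<close>.\<close>
  have eq: "lift U = W" if "independent G U" "?f ` W \<subseteq> U" for U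
  proof -
    have "W \<subseteq> lift U"
      using that(2) by (fastforce simp: lift_def collapse_def split: if_splits)
    then show ?thesis
      using assms lift[OF that(1)] by (auto simp: maximal_independent_def)
  qed
  have ind: "independent G (?f ` W)"
    using assms by (auto simp: maximal_independent_def independent_duplication_iff)
  then show "maximal_independent G (?f ` W)"
    using eq lift unfolding maximal_independent_def by metis
  show "W = (if x \<in> ?f ` W then insert y (?f ` W) else ?f ` W)"
    using eq[OF ind] by (simp add: lift_def)
qed

text \<open>A full preimage could contain both \<open>x\<close> and \<open>y\<close>, so here
  \<open>W\<close> is only enlarged by the vertices of \<open>U\<close> that its image
  misses.\<close>

lemma maximal_independent_expansion:
  assumes "maximal_independent (expansion G x y) W"
  shows "inj_on (collapse x y) W" "maximal_independent G (collapse x y ` W)"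
proof -
  let ?f = "collapse x y"
  have W: "W \<subseteq> insert y (verts G)" "independent G (?f ` W)"
    and inj: "inj_on ?f W"
    using assms by (auto simp: maximal_independent_def independent_expansion_iff)
  show "inj_on ?f W" by (fact inj)
  have "U = ?f ` W" if U: "independent G U" "?f ` W \<subseteq> U" for U
  proof -
    let ?N = "U - ?f ` W"
    have UV: "U \<subseteq> verts G" using U by (simp add: independent_def)
    then have idN: "?f v = v" if "v \<in> ?N" for v
      using that y by (auto simp: collapse_def)
    have img: "?f ` ?N = ?N"
      using UV y by (intro image_collapse_id) auto
    then have "?f ` (W \<union> ?N) = U"
      using U(2) by (auto simp: image_Un)
    moreover have "inj_on ?f (W \<union> ?N)"
    proof -
      have "inj_on ?f ?N"
        using idN by (metis inj_on_cong inj_on_id2)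
      \<comment> \<open>The added vertices are fixed by \<open>collapse\<close> and avoid the image
        of \<open>W\<close>, so injectivity survives.\<close>
      moreover have "?f ` (W - ?N) \<inter> ?f ` (?N - W) = {}"
        using img by blast
      ultimately show ?thesis
        using inj by (simp add: inj_on_Un)
    qed
    ultimately have "independent (expansion G x y) (W \<union> ?N)"
      using U(1) UV W(1) by (auto simp: independent_expansion_iff)
    then have "W \<union> ?N = W"
      using assms unfolding maximal_independent_def by blast
    with \<open>?f ` (W \<union> ?N) = U\<close> show ?thesis by simp
  qed
  then show "maximal_independent G (?f ` W)"
    using W(2) by (auto simp: maximal_independent_def)
qed

end

lemma levelable_duplication:
  assumes "levelable G" "x \<in> verts G" "y \<notin> verts G"
  shows "levelable (duplication G x y)"
proof -
  obtain w :: "'a \<Rightarrow> int" and c where simple: "simple_graph G"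
    and pos: "\<And>v. v \<in> verts G \<Longrightarrow> 0 < w v"
    and level: "\<And>W. maximal_independent G W \<Longrightarrow> sum w W = c"
    using assms(1) unfolding levelable_def by blast
  note ctx = simple assms(2,3)
  define w' where "w' v = (if v = x \<or> v = y then w x else 2 * w v)" for v
  have "sum w' W = 2 * c" if max: "maximal_independent (duplication G x y) W" for W
  proof -
    obtain U where U: "maximal_independent G U" and W: "W = (if x \<in> U then insert y U else U)"
      using maximal_independent_duplication[OF ctx max] .
    have "finite U" "y \<notin> U"
      using U assms(3) simple_graph_independent_finite[OF simple]
      by (auto simp: maximal_independent_def independent_def)
    moreover have "sum w' (U - {x}) = 2 * sum w (U - {x})"
      unfolding sum_distrib_left
      by (rule sum.cong) (use \<open>y \<notin> U\<close> in \<open>auto simp: w'_def\<close>)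
    \<comment> \<open>If \<open>x\<close> is in \<open>U\<close>, then \<open>x\<close> and
      \<open>y\<close> together contribute \<open>2 * w x\<close>; otherwise \<open>W\<close>
      contains neither.\<close>
    ultimately have "sum w' W = 2 * sum w U"
      by (cases "x \<in> U") (simp_all add: W sum.remove[of U x] w'_def[of x] w'_def[of y])
    then show ?thesis by (simp add: level[OF U])
  qed
  moreover have "\<forall>v\<in>verts (duplication G x y). 0 < w' v"
    using pos assms(2) by (auto simp: duplication_def w'_def)
  ultimately show ?thesis
    unfolding levelable_def using simple_graph_duplication[OF ctx] by blast
qed

lemma levelable_expansion:
  assumes "levelable G" "x \<in> verts G" "y \<notin> verts G"
  shows "levelable (expansion G x y)"
proof -
  obtain w :: "'a \<Rightarrow> int" and c where simple: "simple_graph G"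
    and pos: "\<And>v. v \<in> verts G \<Longrightarrow> 0 < w v"
    and level: "\<And>W. maximal_independent G W \<Longrightarrow> sum w W = c"
    using assms(1) unfolding levelable_def by blast
  note ctx = simple assms(2,3)
  define w' where "w' = w \<circ> collapse x y"
  have "sum w' W = c" if max: "maximal_independent (expansion G x y) W" for W
    \<comment> \<open>Injectivity on \<open>W\<close> turns the sum of \<open>w'\<close> over
      \<open>W\<close> into the sum of \<open>w\<close> over the image.\<close>
    using maximal_independent_expansion[OF ctx max] level[of "collapse x y ` W"]
    by (simp add: w'_def sum.reindex)
  moreover have "\<forall>v\<in>verts (expansion G x y). 0 < w' v"
    using pos assms(2) by (auto simp: expansion_def w'_def collapse_def)
  ultimately show ?thesis
    unfolding levelable_def using simple_graph_expansion[OF ctx] by blast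
qed

theorem theorem3p2:
  fixes G :: "'a graph" and x y :: 'a
  assumes "levelable G"
    and "x \<in> verts G"
    and "y \<notin> verts G"
  shows "levelable (duplication G x y) \<and> levelable (expansion G x y)"
  using levelable_duplication[OF assms] levelable_expansion[OF assms] by simp

end
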